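(* For all terms $s,t$ over $\Sigma_{SCL}(A)$ (with variables), $\mathrm{EqSSCL}\vdash s=t$ if and only if $\mathrm{SSCL}\vdash s=t$.
   Context: $A$ is a non-empty set of atoms; $\Sigma_{SCL}(A)=\{\land_s,\lor_s,\neg,\mathsf T,\mathsf F\}\cup A$; $\vdash$ is equational-logic derivability. $\mathrm{EqSSCL}$ consists of (Neg) $\mathsf F=\neg\mathsf T$, (Or) $x\lor_s y=\neg(\neg x\land_s\neg y)$, (Tand) $\mathsf T\land_s x=x$, (Abs) $x\land_s(x\lor_s y)=x$, (Mem) $(x\lor_s y)\land_s z=(\neg x\land_s(y\land_s z))\lor_s(x\land_s z)$, (Comm) $x\land_s y=y\land_s x$. Static short-circuit logic: $\mathrm{SSCL}\vdash s=t$ means $s=t$ is derivable from the following equations over $\Sigma_{SCL}(A)$ extended with Hoare's conditional $x\lhd y\rhd z$ (a hidden operator): (CP1) $x\lhd\mathsf T\rhd y=x$, (CP2) $x\lhd\mathsf F\rhd y=y$, (CP3) $\mathsf T\lhd x\rhd\mathsf F=x$, (CP4) $x\lhd(y\lhd z\rhd u)\rhd v=(x\lhd y\rhd v)\lhd z\rhd(x\lhd u\rhd v)$, (CPmem) $x\lhd y\rhd(z\lhd u\rhd(v\lhd y\rhd w))=x\lhd y\rhd(z\lhd u\rhd w)$, (CPs) $\mathsf F\lhd x\rhd\mathsf F=\mathsf F$, and $\neg x=\mathsf F\lhd x\rhd\mathsf T$, $x\land_s y=y\lhd x\rhd\mathsf F$, $x\lor_s y=\mathsf T\lhd x\rhd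 y$. *)

theory Defs
  imports Main
begin

text \<open>The set \<open>A\<close> of atoms is the type \<open>'a\<close> (types are non-empty); an atom is a constant, not a
  variable. Variables are drawn from the countably infinite type \<^typ>\<open>nat\<close>.\<close>

datatype 'a scl_term =
    SVar nat
  | SAtom 'a
  | STrue
  | SFalse
  | SNeg "'a scl_term"  ("\<sim>\<^sub>s _" [80] 80)
  | SAnd "'a scl_term" "'a scl_term"  (infixr "\<and>\<^sub>s" 70)
  | SOr "'a scl_term" "'a scl_term"  (infixr "\<or>\<^sub>s" 70)

text \<open>Terms over the signature extended with the hidden conditional.\<close>

datatype 'a cp_term =
    CVar nat
  | CAtom 'a
  | CTrue
  | CFalse
  | CNeg "'a cp_term"  ("\<sim>\<^sub>c _" [80] 80)
  | CAnd "'a cp_term" "'a cp_term"  (infixr "\<and>\<^sub>c" 70)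
  | COr "'a cp_term" "'a cp_term"  (infixr "\<or>\<^sub>c" 70)
  | Cond "'a cp_term" "'a cp_term" "'a cp_term"  ("_ \<lhd> _ \<rhd> _" [61, 61, 61] 60)

primrec cp_of_scl :: "'a scl_term \<Rightarrow> 'a cp_term" where
  "cp_of_scl (SVar n) = CVar n"
| "cp_of_scl (SAtom a) = CAtom a"
| "cp_of_scl STrue = CTrue"
| "cp_of_scl SFalse = CFalse"
| "cp_of_scl (\<sim>\<^sub>s x) = \<sim>\<^sub>c (cp_of_scl x)"
| "cp_of_scl (x \<and>\<^sub>s y) = cp_of_scl x \<and>\<^sub>c cp_of_scl y"
| "cp_of_scl (x \<or>\<^sub>s y) = cp_of_scl x \<or>\<^sub>c cp_of_scl y"

primrec scl_subst :: "(nat \<Rightarrow> 'a scl_term) \<Rightarrow> 'a scl_term \<Rightarrow> 'a scl_term" where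
  "scl_subst \<sigma> (SVar n) = \<sigma> n"
| "scl_subst \<sigma> (SAtom a) = SAtom a"
| "scl_subst \<sigma> STrue = STrue"
| "scl_subst \<sigma> SFalse = SFalse"
| "scl_subst \<sigma> (\<sim>\<^sub>s x) = \<sim>\<^sub>s (scl_subst \<sigma> x)"
| "scl_subst \<sigma> (x \<and>\<^sub>s y) = scl_subst \<sigma> x \<and>\<^sub>s scl_subst \<sigma> y"
| "scl_subst \<sigma> (x \<or>\<^sub>s y) = scl_subst \<sigma> x \<or>\<^sub>s scl_subst \<sigma> y"

primrec cp_subst :: "(nat \<Rightarrow> 'a cp_term) \<Rightarrow> 'a cp_term \<Rightarrow> 'a cp_term" where
  "cp_subst \<sigma> (CVar n) = \<sigma> n"
| "cp_subst \<sigma> (CAtom a) = CAtom a"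
| "cp_subst \<sigma> CTrue = CTrue"
| "cp_subst \<sigma> CFalse = CFalse"
| "cp_subst \<sigma> (\<sim>\<^sub>c x) = \<sim>\<^sub>c (cp_subst \<sigma> x)"
| "cp_subst \<sigma> (x \<and>\<^sub>c y) = cp_subst \<sigma> x \<and>\<^sub>c cp_subst \<sigma> y"
| "cp_subst \<sigma> (x \<or>\<^sub>c y) = cp_subst \<sigma> x \<or>\<^sub>c cp_subst \<sigma> y"
| "cp_subst \<sigma> (x \<lhd> y \<rhd> z) = cp_subst \<sigma> x \<lhd> cp_subst \<sigma> y \<rhd> cp_subst \<sigma> z"

text \<open>An equation is a pair of terms. Equational logic over each of the two signatures is reflexivity,
  symmetry, transitivity, congruence and substitution instances of axioms; closure of derivability
  under arbitrary substitutions follows.\<close>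

abbreviation equation :: "'t \<Rightarrow> 't \<Rightarrow> 't \<times> 't"  (infix "\<approx>" 50) where
  "l \<approx> r \<equiv> (l, r)"

inductive scl_derivable :: "('a scl_term \<times> 'a scl_term) set \<Rightarrow> 'a scl_term \<Rightarrow> 'a scl_term \<Rightarrow> bool"
  for E :: "('a scl_term \<times> 'a scl_term) set" where
  scl_axiom: "(l \<approx> r) \<in> E \<Longrightarrow> scl_derivable E (scl_subst \<sigma> l) (scl_subst \<sigma> r)"
| scl_refl: "scl_derivable E x x"
| scl_sym: "scl_derivable E x y \<Longrightarrow> scl_derivable E y x"
| scl_trans: "scl_derivable E x y \<Longrightarrow> scl_derivable E y z \<Longrightarrow> scl_derivable E x z"
| scl_cong_neg: "scl_derivable E x x' \<Longrightarrow> scl_derivable E (\<sim>\<^sub>s x) (\<sim>\<^sub>s x')"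
| scl_cong_and: "scl_derivable E x x' \<Longrightarrow> scl_derivable E y y' \<Longrightarrow>
    scl_derivable E (x \<and>\<^sub>s y) (x' \<and>\<^sub>s y')"
| scl_cong_or: "scl_derivable E x x' \<Longrightarrow> scl_derivable E y y' \<Longrightarrow>
    scl_derivable E (x \<or>\<^sub>s y) (x' \<or>\<^sub>s y')"

inductive cp_derivable :: "('a cp_term \<times> 'a cp_term) set \<Rightarrow> 'a cp_term \<Rightarrow> 'a cp_term \<Rightarrow> bool"
  for E :: "('a cp_term \<times> 'a cp_term) set" where
  cp_axiom: "(l \<approx> r) \<in> E \<Longrightarrow> cp_derivable E (cp_subst \<sigma> l) (cp_subst \<sigma> r)"
| cp_refl: "cp_derivable E x x"
| cp_sym: "cp_derivable E x y \<Longrightarrow> cp_derivable E y x"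
| cp_trans: "cp_derivable E x y \<Longrightarrow> cp_derivable E y z \<Longrightarrow> cp_derivable E x z"
| cp_cong_neg: "cp_derivable E x x' \<Longrightarrow> cp_derivable E (\<sim>\<^sub>c x) (\<sim>\<^sub>c x')"
| cp_cong_and: "cp_derivable E x x' \<Longrightarrow> cp_derivable E y y' \<Longrightarrow>
    cp_derivable E (x \<and>\<^sub>c y) (x' \<and>\<^sub>c y')"
| cp_cong_or: "cp_derivable E x x' \<Longrightarrow> cp_derivable E y y' \<Longrightarrow>
    cp_derivable E (x \<or>\<^sub>c y) (x' \<or>\<^sub>c y')"
| cp_cong_cond: "cp_derivable E x x' \<Longrightarrow> cp_derivable E y y' \<Longrightarrow> cp_derivable E z z' \<Longrightarrow>
    cp_derivable E (x \<lhd> y \<rhd> z) (x' \<lhd> y' \<rhd> z')"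

text \<open>In order: Neg, Or, Tand, Abs, Mem, Comm.\<close>

definition EqSSCL :: "('a scl_term \<times> 'a scl_term) set" where
  "EqSSCL = (let x = SVar 0; y = SVar 1; z = SVar 2 in
    { SFalse \<approx> \<sim>\<^sub>s STrue,
      x \<or>\<^sub>s y \<approx> \<sim>\<^sub>s (\<sim>\<^sub>s x \<and>\<^sub>s \<sim>\<^sub>s y),
      STrue \<and>\<^sub>s x \<approx> x,
      x \<and>\<^sub>s (x \<or>\<^sub>s y) \<approx> x,
      (x \<or>\<^sub>s y) \<and>\<^sub>s z \<approx> (\<sim>\<^sub>s x \<and>\<^sub>s (y \<and>\<^sub>s z)) \<or>\<^sub>s (x \<and>\<^sub>s z),
      x \<and>\<^sub>s y \<approx> y \<and>\<^sub>s x })"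

text \<open>In order: CP1, CP2, CP3, CP4, CPmem, CPs, followed by the defining equations of the
  short-circuit connectives.\<close>

definition SSCL :: "('a cp_term \<times> 'a cp_term) set" where
  "SSCL = (let x = CVar 0; y = CVar 1; z = CVar 2; u = CVar 3; v = CVar 4; w = CVar 5 in
    { x \<lhd> CTrue \<rhd> y \<approx> x,
      x \<lhd> CFalse \<rhd> y \<approx> y,
      CTrue \<lhd> x \<rhd> CFalse \<approx> x,
      x \<lhd> (y \<lhd> z \<rhd> u) \<rhd> v \<approx> (x \<lhd> y \<rhd> v) \<lhd> z \<rhd> (x \<lhd> u \<rhd> v),
      x \<lhd> y \<rhd> (z \<lhd> u \<rhd> (v \<lhd> y \<rhd> w)) \<approx> x \<lhd> y \<rhd> (z \<lhd> u \<rhd> w),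
      CFalse \<lhd> x \<rhd> CFalse \<approx> CFalse,
      \<sim>\<^sub>c x \<approx> CFalse \<lhd> x \<rhd> CTrue,
      x \<and>\<^sub>c y \<approx> y \<lhd> x \<rhd> CFalse,
      x \<or>\<^sub>c y \<approx> CTrue \<lhd> x \<rhd> y })"

end

theory Submission
  imports Defs
begin

text \<open>The models of \<open>EqSSCL\<close> are exactly the Boolean algebras, and so are those of \<open>SSCL\<close>, with
  \<open>x \<lhd> y \<rhd> z\<close> read as \<open>(y \<and> x) \<or> (\<not> y \<and> z)\<close>. Applied to the two term algebras modulo derivability,
  this shows that the embedding of terms and the elimination of the conditional both preserve
  derivability; since the elimination inverts the embedding, the theorem follows.\<close>

section \<open>Algebras satisfying the two axiom systems\<close>

locale sscl_algebra =
  fixes neg :: "'b \<Rightarrow> 'b" and con dis :: "'b \<Rightarrow> 'b \<Rightarrow> 'b" and tt ff :: 'b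
  assumes Neg: "ff = neg tt"
    and Or: "dis x y = neg (con (neg x) (neg y))"
    and Tand: "con tt x = x"
    and Abs: "con x (dis x y) = x"
    and Mem: "con (dis x y) z = dis (con (neg x) (con y z)) (con x z)"
    and Comm: "con x y = con y x"

section \<open>Laws of the conditional and the EqSSCL laws they imply\<close>

locale conditional_algebra =
  fixes cond :: "'b \<Rightarrow> 'b \<Rightarrow> 'b \<Rightarrow> 'b"
    and neg :: "'b \<Rightarrow> 'b" and con dis :: "'b \<Rightarrow> 'b \<Rightarrow> 'b" and tt ff :: 'b
  assumes CP1: "cond x tt y = x"
    and CP2: "cond x ff y = y"
    and CP3: "cond tt x ff = x"
    and CP4: "cond x (cond y z u) v = cond (cond x y v) z (cond x u v)"
    and CPmem: "cond x y (cond z u (cond v y w)) = cond x y (cond z u w)"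
    and CPs: "cond ff x ff = ff"
    and neg_cond: "neg x = cond ff x tt"
    and con_cond: "con x y = cond y x ff"
    and dis_cond: "dis x y = cond tt x y"
begin

text \<open>\<open>cond ff y tt\<close> is the negation of \<open>y\<close>; negating tests yields
  the mirror images of CPmem below.\<close>

lemma cond_swap: "cond x (cond ff y tt) z = cond z y x"
  by (simp add: CP4 CP1 CP2)

text \<open>In CP2, write the test \<open>ff\<close> as \<open>cond ff x ff\<close> by CPs and
  distribute with CP4.\<close>

lemma cond_same: "cond y x y = y"
  by (metis CP2 CP4 CPs)

lemma CPmem_right_left: "cond x y (cond (cond v y w) u z) = cond x y (cond w u z)"
  by (metis CPmem cond_swap)

lemma CPmem_left_right: "cond (cond z u (cond v y w)) y x = cond (cond z u v) y x"
  by (metis CPmem cond_swap)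

lemma CPmem_left_left: "cond (cond (cond v y w) u z) y x = cond (cond v u z) y x"
  by (metis CPmem_right_left cond_swap)

lemma cond_ff_commute: "cond y x ff = cond x y ff"
proof -
  \<comment> \<open>The whole is put under a test of \<open>y\<close>, with \<open>y\<close>
    expanded by CP3; memory then settles the inner tests of \<open>y\<close>, to \<open>tt\<close>
    on the left and \<open>ff\<close> on the right.\<close>
  have "cond y x ff = cond (cond (cond tt y ff) x ff) y (cond (cond tt y ff) x ff)"
    by (subst cond_same) (simp only: CP3)
  also have "\<dots> = cond (cond tt x ff) y (cond ff x ff)"
    by (simp only: CPmem_right_left CPmem_left_left)
  also have "\<dots> = cond x y ff"
    by (simp only: CP3 CPs)
  finally show ?thesis .
qed

sublocale sscl_algebra neg con dis tt ff
proof
  fix x y z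
  show "ff = neg tt"
    by (simp add: neg_cond CP1)
  show "dis x y = neg (con (neg x) (neg y))"
    unfolding neg_cond con_cond dis_cond by (simp add: CP1 CP2 CP3 CP4 CPs cond_same)
  show "con tt x = x"
    by (simp add: con_cond CP1)
  show "con x (dis x y) = x"
    \<comment> \<open>With middle test \<open>tt\<close>, \<open>CPmem_left_left\<close> reduces
      \<open>cond (cond tt x y) x ff\<close> to \<open>cond tt x ff\<close>, which commutes to
      \<open>x\<close>.\<close>
    unfolding con_cond dis_cond by (metis CP1 cond_ff_commute CPmem_left_left)
  show "con (dis x y) z = dis (con (neg x) (con y z)) (con x z)"
    unfolding neg_cond con_cond dis_cond by (metis CP1 CP2 CP3 CP4 CPmem_left_right)
  show "con x y = con y x"
    unfolding con_cond by (rule cond_ff_commute)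
qed

end

section \<open>Boolean laws from EqSSCL\<close>

context sscl_algebra
begin

lemma dis_commute: "dis x y = dis y x"
  by (simp add: Or Comm)

lemma dis_tt: "dis tt y = tt"
  by (metis Abs Tand)

lemma dis_absorb_neg: "dis x y = dis (con (neg x) y) x"
  using Mem[of x y tt] by (simp add: Comm[of _ tt] Tand)

text \<open>Mem at \<open>x = tt\<close> makes every element a disjunction, hence by Or some
  \<open>neg w\<close>; it also gives \<open>neg w = neg (neg (neg w))\<close>.\<close>

lemma neg_neg: "neg (neg x) = x"
  by (metis Mem Or Tand dis_tt)

lemma con_ff: "con ff x = ff"
  by (metis Neg Or dis_tt neg_neg)

lemma dis_ff: "dis ff x = x"
  by (metis Or Neg neg_neg Tand)

text \<open>\<open>dis_absorb_neg\<close> at \<open>y = tt\<close> gives excluded middle; De Morgan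
  gives this dual.\<close>

lemma con_neg: "con x (neg x) = ff"
  by (metis Abs Comm Neg Or Tand dis_absorb_neg neg_neg)

lemma dis_neg: "dis x (neg x) = tt"
  by (metis Neg Or con_neg neg_neg Comm)

lemma dis_con_absorb: "dis x (con x y) = x"
  by (metis Abs Or neg_neg)

lemma con_absorb_neg: "con x y = con x (dis (neg x) y)"
  by (metis dis_absorb_neg Or neg_neg Comm)

text \<open>\<open>con_absorb_neg\<close> turns the second factor into
  \<open>dis (neg x) (con (neg x) y)\<close>, which absorbs to \<open>neg x\<close>. This stands in
  for associativity in the distributivity proof.\<close>

lemma con_con_neg: "con x (con (neg x) y) = ff"
  by (metis dis_con_absorb con_neg con_absorb_neg)

text \<open>By \<open>Mem\<close> and absorption it suffices that \<open>y \<and> z\<close> has the same meet with \<open>\<not> (x \<and> z)\<close> as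
  with \<open>\<not> x\<close>.\<close>

lemma con_dis_distrib: "con (dis x y) z = dis (con x z) (con y z)"
proof -
  have z: "con z (con (neg z) y) = ff" "con (neg z) (con z y) = ff"
    using con_con_neg[of z] con_con_neg[of "neg z"] by (simp_all add: neg_neg)
  have "con (neg (con x z)) (con y z) = con (dis (neg x) (neg z)) (con y z)"
    by (simp add: Or neg_neg)
  also have "\<dots> = dis (con x (con (neg z) (con z y))) (con (neg x) (con y z))"
    by (simp add: Mem neg_neg Comm[of y z])
  also have "\<dots> = con (neg x) (con y z)"
    by (simp add: z Comm[of x] con_ff dis_ff)
  finally show ?thesis
    using Mem[of x y z] dis_absorb_neg[of "con x z" "con y z"] by simp
qed

lemma dis_con_distrib: "dis (con x y) z = con (dis x z) (dis y z)"
  using con_dis_distrib[of "neg x" "neg y" "neg z"] by (metis Or neg_neg)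

text \<open>Both bracketings lie below each of \<open>x\<close>, \<open>y\<close>, \<open>z\<close>, hence below each other.\<close>

lemma con_assoc: "con (con x y) z = con x (con y z)"
proof -
  \<comment> \<open>\<open>dis v c = v\<close> encodes that \<open>c\<close> lies below
    \<open>v\<close>; distributing and absorbing leaves \<open>con (dis u v) v\<close>.\<close>
  have below: "dis v (con u (con v w)) = v" for u v w
    by (metis Abs dis_con_absorb dis_con_distrib dis_commute Comm)
  define A where "A = con (con x y) z"
  define B where "B = con x (con y z)"
  have A: "dis x A = x" "dis y A = y" "dis z A = z"
    using below[of x z y] below[of y z x] dis_con_absorb[of z "con x y"]
    by (simp_all add: A_def Comm)
  have B: "dis x B = x" "dis y B = y" "dis z B = z"
    using below[of y x z] below[of z x y] dis_con_absorb[of x "con y z"]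
    by (simp_all add: B_def Comm)
  have "dis A B = A"
    by (subst A_def) (simp add: dis_con_distrib B A_def)
  moreover have "dis B A = B"
    by (subst B_def) (simp add: dis_con_distrib A B_def)
  ultimately show ?thesis
    by (simp add: A_def B_def dis_commute)
qed

lemma dis_assoc: "dis (dis x y) z = dis x (dis y z)"
  by (simp add: Or neg_neg con_assoc)

sublocale abstract_boolean_algebra con dis neg ff tt
proof
  fix x y z
  show "con (con x y) z = con x (con y z)" by (rule con_assoc)
  show "con x y = con y x" by (rule Comm)
  show "dis (dis x y) z = dis x (dis y z)" by (rule dis_assoc)
  show "dis x y = dis y x" by (rule dis_commute)
  show "con x (dis y z) = dis (con x y) (con x z)"
    by (simp only: Comm[of x] con_dis_distrib)
  show "dis x (con y z) = con (dis x y) (dis x z)"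
    by (simp only: dis_commute[of x] dis_con_distrib)
  show "con x tt = x" by (simp only: Comm[of x] Tand)
  show "dis x ff = x" by (simp only: dis_commute[of x] dis_ff)
  show "con x (neg x) = ff" by (rule con_neg)
  show "dis x (neg x) = tt" by (rule dis_neg)
qed

text \<open>Excluded middle and distributivity recover an element from its meets with
  \<open>p\<close> and \<open>neg p\<close>.\<close>

lemma eq_by_cases:
  assumes "con p a = con p b" and "con (neg p) a = con (neg p) b"
  shows "a = b"
proof -
  have "c = dis (con p c) (con (neg p) c)" for c
    by (simp flip: con_dis_distrib)
  with assms show ?thesis by metis
qed

section \<open>The conditional in a Boolean algebra\<close>

definition cond :: "'b \<Rightarrow> 'b \<Rightarrow> 'b \<Rightarrow> 'b" where
  "cond x y z = dis (con y x) (con (neg y) z)"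

lemma con_cond_left: "con y (cond x y z) = con y x"
  by (simp add: cond_def conj_disj_distribs flip: conj.assoc)

lemma con_cond_right: "con (neg y) (cond x y z) = con (neg y) z"
  by (simp add: cond_def conj_disj_distribs flip: conj.assoc)

lemma con_cond_distrib: "con p (cond x y z) = cond (con p x) y (con p z)"
  by (simp add: cond_def conj_disj_distribs ac_simps)

text \<open>Below \<open>p\<close>, a complement depends only on the part of its argument below
  \<open>p\<close>; so negation can enter the branches of a conditional.\<close>

lemma con_neg_con: "con p (neg (con p q)) = con p (neg q)"
  by (metis Or neg_neg con_absorb_neg)

lemma neg_of_cond: "neg (cond x y z) = cond (neg x) y (neg z)"
  by (rule eq_by_cases[of y]) (metis con_neg_con con_cond_left con_cond_right)+

lemma conditional_algebra: "conditional_algebra cond neg con dis tt ff"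
proof
  fix x y z u v w
  show "cond x (cond y z u) v = cond (cond x y v) z (cond x u v)"
    \<comment> \<open>Only the outer conditional is expanded first, so that the negated test becomes
      a conditional again rather than a product of sums.\<close>
    unfolding cond_def[of x "cond y z u"] neg_of_cond
    by (simp add: cond_def conj_disj_distribs ac_simps)
  \<comment> \<open>Below \<open>neg y\<close>, the restriction moves into the branches of the test
    \<open>u\<close>, where the inner conditional reduces to \<open>w\<close>.\<close>
  show "cond x y (cond z u (cond v y w)) = cond x y (cond z u w)"
    by (rule eq_by_cases[of y])
      (simp_all only: con_cond_left con_cond_right con_cond_distrib[of _ z u])
  show "dis x y = cond tt x y"
    by (simp add: cond_def dis_absorb_neg[of x y] disj.commute)
qed (simp_all add: cond_def conj_one_right flip: con_dis_distrib)

end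

section \<open>Derivability of translated equations\<close>

quotient_type 'a scl_class = "'a scl_term" / "scl_derivable EqSSCL"
  by (rule equivpI) (auto intro!: reflpI sympI transpI intro: scl_refl scl_sym scl_trans)

lift_definition scl_class_neg :: "'a scl_class \<Rightarrow> 'a scl_class" is SNeg
  by (rule scl_cong_neg)
lift_definition scl_class_and :: "'a scl_class \<Rightarrow> 'a scl_class \<Rightarrow> 'a scl_class" is SAnd
  by (rule scl_cong_and)
lift_definition scl_class_or :: "'a scl_class \<Rightarrow> 'a scl_class \<Rightarrow> 'a scl_class" is SOr
  by (rule scl_cong_or)
lift_definition scl_class_true :: "'a scl_class" is STrue .
lift_definition scl_class_false :: "'a scl_class" is SFalse .

quotient_type 'a cp_class = "'a cp_term" / "cp_derivable SSCL"
  by (rule equivpI) (auto intro!: reflpI sympI transpI intro: cp_refl cp_sym cp_trans)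

lift_definition cp_class_neg :: "'a cp_class \<Rightarrow> 'a cp_class" is CNeg
  by (rule cp_cong_neg)
lift_definition cp_class_and :: "'a cp_class \<Rightarrow> 'a cp_class \<Rightarrow> 'a cp_class" is CAnd
  by (rule cp_cong_and)
lift_definition cp_class_or :: "'a cp_class \<Rightarrow> 'a cp_class \<Rightarrow> 'a cp_class" is COr
  by (rule cp_cong_or)
lift_definition cp_class_cond :: "'a cp_class \<Rightarrow> 'a cp_class \<Rightarrow> 'a cp_class \<Rightarrow> 'a cp_class" is Cond
  by (rule cp_cong_cond)
lift_definition cp_class_true :: "'a cp_class" is CTrue .
lift_definition cp_class_false :: "'a cp_class" is CFalse .

text \<open>Quantifying over the axiom set lets one substitution deliver all axioms as a
  conjunction.\<close>

lemma scl_axiom_instances: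
  "\<forall>(l, r) \<in> EqSSCL. abs_scl_class (scl_subst \<sigma> l) = abs_scl_class (scl_subst \<sigma> r)"
  by (auto simp: scl_class.abs_eq_iff intro: scl_axiom)

lemma cp_axiom_instances:
  "\<forall>(l, r) \<in> SSCL. abs_cp_class (cp_subst \<sigma> l) = abs_cp_class (cp_subst \<sigma> r)"
  by (auto simp: cp_class.abs_eq_iff intro: cp_axiom)

lemmas fold_scl_class = scl_class_true_def[symmetric] scl_class_false_def[symmetric]
  scl_class_neg.abs_eq[symmetric] scl_class_and.abs_eq[symmetric] scl_class_or.abs_eq[symmetric]

lemmas fold_cp_class = cp_class_true_def[symmetric] cp_class_false_def[symmetric]
  cp_class_neg.abs_eq[symmetric] cp_class_and.abs_eq[symmetric] cp_class_or.abs_eq[symmetric]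
  cp_class_cond.abs_eq[symmetric]

interpretation scl_class:
  sscl_algebra scl_class_neg scl_class_and scl_class_or scl_class_true scl_class_false
proof -
  have "abs_scl_class (rep_scl_class x) = x" for x :: "'a scl_class"
    by (rule Quotient3_abs_rep[OF Quotient3_scl_class])
  then have "scl_class_false = (scl_class_neg scl_class_true :: 'a scl_class) \<and>
      scl_class_or x y =
        scl_class_neg (scl_class_and (scl_class_neg x) (scl_class_neg y)) \<and>
      scl_class_and scl_class_true x = x \<and>
      scl_class_and x (scl_class_or x y) = x \<and>
      scl_class_and (scl_class_or x y) z =
        scl_class_or (scl_class_and (scl_class_neg x) (scl_class_and y z)) (scl_class_and x z) \<and>
      scl_class_and x y = scl_class_and y x" for x y z :: "'a scl_class"
    \<comment> \<open>The substitution sends variables 0, 1, 2 to representatives of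
      \<open>x\<close>, \<open>y\<close>, \<open>z\<close>; no other variable occurs in the
      axioms.\<close>
    using scl_axiom_instances[of "(!) (map rep_scl_class [x, y, z])"]
    by (clarsimp simp add: EqSSCL_def Let_def fold_scl_class)
  then show "sscl_algebra scl_class_neg scl_class_and scl_class_or scl_class_true
      (scl_class_false :: 'a scl_class)"
    by unfold_locales blast+
qed

interpretation scl_class_cond: conditional_algebra scl_class.cond scl_class_neg scl_class_and
  scl_class_or scl_class_true scl_class_false
  by (rule scl_class.conditional_algebra)

interpretation cp_class: conditional_algebra cp_class_cond cp_class_neg cp_class_and cp_class_or
  cp_class_true cp_class_false
proof -
  have "abs_cp_class (rep_cp_class x) = x" for x :: "'a cp_class"
    by (rule Quotient3_abs_rep[OF Quotient3_cp_class])
  then have "cp_class_cond x cp_class_true y = x \<and>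
      cp_class_cond x cp_class_false y = y \<and>
      cp_class_cond cp_class_true x cp_class_false = x \<and>
      cp_class_cond x (cp_class_cond y z u) v =
        cp_class_cond (cp_class_cond x y v) z (cp_class_cond x u v) \<and>
      cp_class_cond x y (cp_class_cond z u (cp_class_cond v y w)) =
        cp_class_cond x y (cp_class_cond z u w) \<and>
      cp_class_cond cp_class_false x cp_class_false = cp_class_false \<and>
      cp_class_neg x = cp_class_cond cp_class_false x cp_class_true \<and>
      cp_class_and x y = cp_class_cond y x cp_class_false \<and>
      cp_class_or x y = cp_class_cond cp_class_true x y" for x y z u v w :: "'a cp_class"
    using cp_axiom_instances[of "(!) (map rep_cp_class [x, y, z, u, v, w])"]
    by (simp add: SSCL_def Let_def fold_cp_class)
  then show "conditional_algebra cp_class_cond cp_class_neg cp_class_and cp_class_or cp_class_true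
      (cp_class_false :: 'a cp_class)"
    by unfold_locales blast+
qed

section \<open>Eliminating the conditional and transferring derivations\<close>

primrec scl_of_cp :: "'a cp_term \<Rightarrow> 'a scl_term" where
  "scl_of_cp (CVar n) = SVar n"
| "scl_of_cp (CAtom a) = SAtom a"
| "scl_of_cp CTrue = STrue"
| "scl_of_cp CFalse = SFalse"
| "scl_of_cp (\<sim>\<^sub>c x) = \<sim>\<^sub>s (scl_of_cp x)"
| "scl_of_cp (x \<and>\<^sub>c y) = scl_of_cp x \<and>\<^sub>s scl_of_cp y"
| "scl_of_cp (x \<or>\<^sub>c y) = scl_of_cp x \<or>\<^sub>s scl_of_cp y"
| "scl_of_cp (x \<lhd> y \<rhd> z) =
    (scl_of_cp y \<and>\<^sub>s scl_of_cp x) \<or>\<^sub>s (\<sim>\<^sub>s (scl_of_cp y) \<and>\<^sub>s scl_of_cp z)"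

lemma scl_of_cp_of_scl: "scl_of_cp (cp_of_scl s) = s"
  by (induction s) auto

lemma abs_scl_of_cp_cond:
  "abs_scl_class (scl_of_cp (x \<lhd> y \<rhd> z)) =
    scl_class.cond (abs_scl_class (scl_of_cp x)) (abs_scl_class (scl_of_cp y))
      (abs_scl_class (scl_of_cp z))"
  by (simp add: scl_class.cond_def scl_class_neg.abs_eq scl_class_and.abs_eq scl_class_or.abs_eq)

text \<open>\<open>abs_scl_of_cp_cond\<close> replaces the \<open>Cond\<close> clause of
  \<open>scl_of_cp\<close>, so that goals keep \<open>scl_class.cond\<close> and match the
  conditional laws.\<close>

lemmas abs_scl_of_cp = abs_scl_of_cp_cond scl_of_cp.simps(3-7) fold_scl_class

lemma SSCL_translated:
  assumes "(l \<approx> r) \<in> SSCL"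
  shows "scl_derivable EqSSCL (scl_of_cp (cp_subst \<sigma> l)) (scl_of_cp (cp_subst \<sigma> r))"
proof -
  have "abs_scl_class (scl_of_cp (cp_subst \<sigma> l)) = abs_scl_class (scl_of_cp (cp_subst \<sigma> r))"
    using assms unfolding SSCL_def Let_def
    by (elim insertE; clarsimp simp only: cp_subst.simps abs_scl_of_cp prod.inject)
      (rule scl_class_cond.CP1 scl_class_cond.CP2 scl_class_cond.CP3 scl_class_cond.CP4 scl_class_cond.CPmem scl_class_cond.CPs
        scl_class_cond.neg_cond scl_class_cond.con_cond scl_class_cond.dis_cond | simp)+
  then show ?thesis
    by (simp add: scl_class.abs_eq_iff)
qed

lemma EqSSCL_translated:
  assumes "(l \<approx> r) \<in> EqSSCL"
  shows "cp_derivable SSCL (cp_of_scl (scl_subst \<sigma> l)) (cp_of_scl (scl_subst \<sigma> r))"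
proof -
  have "abs_cp_class (cp_of_scl (scl_subst \<sigma> l)) = abs_cp_class (cp_of_scl (scl_subst \<sigma> r))"
    using assms unfolding EqSSCL_def Let_def
    by (elim insertE; clarsimp simp only: scl_subst.simps cp_of_scl.simps prod.inject
        fold_cp_class)
      (rule cp_class.Neg cp_class.Or cp_class.Tand cp_class.Abs cp_class.Mem cp_class.Comm | simp)+
  then show ?thesis
    by (simp add: cp_class.abs_eq_iff)
qed

lemma cp_of_scl_derivable:
  "scl_derivable EqSSCL s t \<Longrightarrow> cp_derivable SSCL (cp_of_scl s) (cp_of_scl t)"
  by (induction rule: scl_derivable.induct) (auto intro: EqSSCL_translated cp_derivable.intros(2-))

text \<open>A translated conditional is built from connectives, so their congruence rules cover the
  congruence of \<open>Cond\<close>.\<close>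

lemma scl_of_cp_derivable:
  "cp_derivable SSCL s t \<Longrightarrow> scl_derivable EqSSCL (scl_of_cp s) (scl_of_cp t)"
  by (induction rule: cp_derivable.induct) (auto intro: SSCL_translated scl_derivable.intros(2-))

theorem theorem6p5:
  fixes s t :: "'a scl_term"
  shows "scl_derivable EqSSCL s t \<longleftrightarrow> cp_derivable SSCL (cp_of_scl s) (cp_of_scl t)"
  using cp_of_scl_derivable scl_of_cp_derivable[of "cp_of_scl s" "cp_of_scl t"]
  by (auto simp: scl_of_cp_of_scl)

end
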